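(* Let $\lambda,\Lambda>0$ and $0<\delta<1$. Then there exist constants $\bar\epsilon,\bar\mu>0$, depending only on $n,\lambda,\Lambda,\delta$, such that the following holds. Let $a_{ij},b_i,c\in L^\infty(B_1)$ satisfy $$|a_{ij}(x)|+|b_i(x)|+|c(x)|\le\Lambda,\qquad a_{ij}(x)\xi_i\xi_j\ge\lambda|\xi|^2\qquad\text{for all }x\in B_1,\ \xi\in\mathbb{R}^n,$$ and let $u\in LSC(B_1)$ satisfy $$a_{ij}(x)\partial_{ij}u+b_i(x)\partial_iu+c(x)u\le\bar\epsilon\quad\text{in }B_1\text{ in the viscosity sense},$$ $$u\ge1\ \text{ on }B_\delta,\qquad u\ge0\ \text{ in }B_1.$$ Then $$u(x)\ge\bar\mu(1-|x|)\quad\text{on }B_1.$$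
   Context: $B_r$ is the open ball in $\mathbb{R}^n$ of radius $r$ centered at the origin. $LSC(B_1)$ is the set of lower-semicontinuous functions on $B_1$. Repeated indices are summed over $1,\dots,n$. The coefficients are bounded measurable functions defined at every point of $B_1$. Viscosity sense: whenever $x_0\in B_1$ and $\varphi$ is $C^2$ near $x_0$ with $\varphi\le u$ near $x_0$ and $\varphi(x_0)=u(x_0)$, one has $a_{ij}(x_0)\partial_{ij}\varphi(x_0)+b_i(x_0)\partial_i\varphi(x_0)+c(x_0)\varphi(x_0)\le\bar\epsilon$. *)

theory Defs
  imports "HOL-Analysis.Analysis"
begin

text \<open>Functions on \<open>S\<close> are represented by total functions; none of the notions below depends on
  values outside \<open>S\<close>, provided \<open>S\<close> is open in the case of \<open>C2_on\<close> and
  \<open>viscosity_supersolution_on\<close>.\<close>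

definition lsc_on :: "'a::topological_space set \<Rightarrow> ('a \<Rightarrow> real) \<Rightarrow> bool" where
  "lsc_on S u \<longleftrightarrow> (\<forall>x\<in>S. \<forall>y<u x. \<forall>\<^sub>F z in at x within S. y < u z)"

text \<open>Bounded (everywhere, not just almost everywhere) Lebesgue measurable functions: pointwise
  representatives of elements of \<open>L\<close>-infinity.\<close>

definition bounded_measurable_on :: "'a::euclidean_space set \<Rightarrow> ('a \<Rightarrow> real) \<Rightarrow> bool" where
  "bounded_measurable_on S f \<longleftrightarrow> f \<in> borel_measurable (lebesgue_on S) \<and> bounded (f ` S)"

definition partial_deriv :: "'n::finite \<Rightarrow> (real^'n \<Rightarrow> real) \<Rightarrow> real^'n \<Rightarrow> real" where
  "partial_deriv i f x = frechet_derivative f (at x) (axis i 1)"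

text \<open>Meant for open \<open>U\<close>. Continuity of \<open>f\<close> and of its first partial derivatives is
  implied by their differentiability.\<close>

definition C2_on :: "(real^'n::finite) set \<Rightarrow> (real^'n \<Rightarrow> real) \<Rightarrow> bool" where
  "C2_on U f \<longleftrightarrow> f differentiable_on U \<and>
     (\<forall>i. partial_deriv i f differentiable_on U) \<and>
     (\<forall>i j. continuous_on U (partial_deriv i (partial_deriv j f)))"

definition elliptic_op ::
  "(real^'n::finite \<Rightarrow> real^'n^'n) \<Rightarrow> (real^'n \<Rightarrow> real^'n) \<Rightarrow> (real^'n \<Rightarrow> real) \<Rightarrow>
    (real^'n \<Rightarrow> real) \<Rightarrow> real^'n \<Rightarrow> real" where
  "elliptic_op a b c f x =
     (\<Sum>i\<in>UNIV. \<Sum>j\<in>UNIV. a x $ i $ j * partial_deriv i (partial_deriv j f) x)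
     + (\<Sum>i\<in>UNIV. b x $ i * partial_deriv i f x) + c x * f x"

text \<open>\<open>a\<^sub>i\<^sub>j \<partial>\<^sub>i\<^sub>j u + b\<^sub>i \<partial>\<^sub>i u + c u \<le> \<epsilon>\<close> on the open set \<open>S\<close> in the viscosity sense.\<close>

definition viscosity_supersolution_on ::
  "(real^'n::finite) set \<Rightarrow> (real^'n \<Rightarrow> real^'n^'n) \<Rightarrow> (real^'n \<Rightarrow> real^'n) \<Rightarrow> (real^'n \<Rightarrow> real) \<Rightarrow>
    real \<Rightarrow> (real^'n \<Rightarrow> real) \<Rightarrow> bool" where
  "viscosity_supersolution_on S a b c \<epsilon> u \<longleftrightarrow>
     (\<forall>x\<^sub>0\<in>S. \<forall>\<phi>. (\<exists>U. open U \<and> x\<^sub>0 \<in> U \<and> C2_on U \<phi>) \<longrightarrow>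
        (\<forall>\<^sub>F x in nhds x\<^sub>0. \<phi> x \<le> u x) \<longrightarrow> \<phi> x\<^sub>0 = u x\<^sub>0 \<longrightarrow>
        elliptic_op a b c \<phi> x\<^sub>0 \<le> \<epsilon>)"

end

theory Submission
  imports Defs
begin

text \<open>
  The proof is by a Gaussian barrier. Let \<open>\<phi>(x) = exp (-\<alpha>|x|\<^sup>2) - exp (-\<alpha>)\<close>, which vanishes on the
  unit sphere and is at most 1. For large \<open>\<alpha>\<close>, ellipticity makes the term
  \<open>4\<alpha>\<^sup>2 a\<^sub>i\<^sub>j x\<^sub>i x\<^sub>j exp (-\<alpha>|x|\<^sup>2)\<close> of \<open>a\<^sub>i\<^sub>j \<partial>\<^sub>i\<^sub>j \<phi>\<close> dominate all other terms away from the ball of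
  radius \<open>\<delta>\<close> (\<open>elliptic_op_gaussian_ge\<close>).

  The claim is that \<open>u \<ge> \<phi>\<close>. Otherwise \<open>u - \<phi>\<close> has a negative infimum over the unit ball. The
  infimum is attained at some \<open>x\<^sub>0\<close>, because \<open>u - \<phi>\<close> is lower semicontinuous and, \<open>u\<close> being
  nonnegative, is at least \<open>-\<phi>\<close>, which tends to 0 at the boundary
  (\<open>lsc_attains_negative_inf_ball\<close>). Moreover \<open>|x\<^sub>0| \<ge> \<delta>\<close>, because \<open>u \<ge> 1 \<ge> \<phi>\<close> on the smaller
  ball. Hence \<open>\<phi>\<close> lowered by a constant touches \<open>u\<close> from below at \<open>x\<^sub>0\<close>.

  Since \<open>c\<close> may change sign, there is no general comparison principle to quote; the comparison works
  here because the zeroth-order term at the touching point is \<open>c(x\<^sub>0) u(x\<^sub>0)\<close>, where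
  \<open>0 \<le> u(x\<^sub>0) < \<phi>(x\<^sub>0) \<le> exp (-\<alpha>|x\<^sub>0|\<^sup>2)\<close>, so the dominating second-order term absorbs it for either
  sign of \<open>c(x\<^sub>0)\<close>. The lowered barrier therefore violates the supersolution inequality with
  \<open>\<epsilon> = exp (-\<alpha>) / 2\<close>.

  Finally \<open>\<phi>(x) = exp (-\<alpha>) (exp (\<alpha>(1 - |x|\<^sup>2)) - 1) \<ge> \<alpha> exp (-\<alpha>) (1 - |x|)\<close>, which gives
  \<open>\<mu> = \<alpha> exp (-\<alpha>)\<close>.
\<close>

lemma lsc_on_subset:
  assumes "lsc_on S f" and "T \<subseteq> S"
  shows "lsc_on T f"
  unfolding lsc_on_def
proof (intro ballI allI impI)
  fix x y assume "x \<in> T" "y < f x"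
  then have "\<forall>\<^sub>F z in at x within S. y < f z"
    using assms unfolding lsc_on_def by blast
  then show "\<forall>\<^sub>F z in at x within T. y < f z"
    by (rule filter_leD[OF at_le[OF assms(2)]])
qed

lemma lsc_on_diff_continuous:
  assumes "lsc_on S f" and "continuous_on S g"
  shows "lsc_on S (\<lambda>x. f x - g x)"
  unfolding lsc_on_def
proof (intro ballI allI impI)
  fix x y assume x: "x \<in> S" and y: "y < f x - g x"
  define e where "e = (f x - g x - y) / 2"
  have e: "e > 0" using y by (simp add: e_def)
  have "\<forall>\<^sub>F z in at x within S. f x - e < f z"
    using assms(1) x e unfolding lsc_on_def by simp
  moreover have "\<forall>\<^sub>F z in at x within S. g z < g x + e"
    using assms(2) x e unfolding continuous_on_def by (auto intro: order_tendstoD(2))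
  ultimately show "\<forall>\<^sub>F z in at x within S. y < f z - g z"
    by eventually_elim (simp add: e_def field_simps)
qed

text \<open>If the infimum were not attained, every point would have a neighbourhood on which \<open>f\<close>
  exceeds some value of \<open>f\<close>; the least of these values over a finite subcover cannot be
  a value of \<open>f\<close>.\<close>

lemma lsc_attains_inf:
  fixes f :: "'a::topological_space \<Rightarrow> real"
  assumes "compact K" and "K \<noteq> {}" and "lsc_on K f"
  shows "\<exists>x\<in>K. \<forall>y\<in>K. f x \<le> f y"
proof (rule ccontr)
  assume "\<not> ?thesis"
  then have "\<forall>x\<in>K. \<exists>y\<in>K. f y < f x" by (auto simp: not_le)
  then obtain p where p: "\<And>x. x \<in> K \<Longrightarrow> p x \<in> K \<and> f (p x) < f x" by metis
  have "\<exists>U. open U \<and> x \<in> U \<and> (\<forall>z\<in>U \<inter> K. f (p x) < f z)" if "x \<in> K" for x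
  proof -
    have "\<forall>\<^sub>F z in at x within K. f (p x) < f z"
      using assms(3) p[OF that] that unfolding lsc_on_def by blast
    then obtain U where U: "open U" "x \<in> U" "\<forall>z\<in>U. z \<noteq> x \<longrightarrow> z \<in> K \<longrightarrow> f (p x) < f z"
      unfolding eventually_at_topological by blast
    have "f (p x) < f z" if "z \<in> U \<inter> K" for z
      using U(3) p[OF \<open>x \<in> K\<close>] that by (cases "z = x") auto
    then show ?thesis using U(1,2) by blast
  qed
  then obtain U where U: "\<And>x. x \<in> K \<Longrightarrow> open (U x) \<and> x \<in> U x \<and> (\<forall>z\<in>U x \<inter> K. f (p x) < f z)"
    by metis
  obtain C where C: "C \<subseteq> K" "finite C" "K \<subseteq> (\<Union>x\<in>C. U x)"
    by (rule compactE_image[OF assms(1), of K U]) (use U in auto)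
  have "C \<noteq> {}" using C assms(2) by auto
  then obtain m where m: "m \<in> C" "\<And>x. x \<in> C \<Longrightarrow> f (p m) \<le> f (p x)"
    using arg_min_if_finite[OF C(2), of "\<lambda>x. f (p x)"] by (metis linorder_not_le)
  have "p m \<in> K" using p m C by blast
  then obtain x where x: "x \<in> C" "p m \<in> U x" using C by blast
  then have "f (p x) < f (p m)" using U \<open>p m \<in> K\<close> C by blast
  then show False using m(2)[OF x(1)] by simp
qed

text \<open>The lower bound \<open>-h(|x|)\<close>, which tends to 0 at the boundary, keeps minimizing sequences inside
  a smaller closed ball.\<close>

lemma lsc_attains_negative_inf_ball:
  fixes f :: "'a::euclidean_space \<Rightarrow> real"
  assumes lsc: "lsc_on (ball 0 1) f"
    and bound: "\<And>x. x \<in> ball 0 1 \<Longrightarrow> f x \<ge> - h (norm x)"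
    and h: "(h \<longlongrightarrow> 0) (at_left 1)"
    and y: "y \<in> ball 0 1" "f y < 0"
  shows "\<exists>x\<in>ball 0 1. f x < 0 \<and> (\<forall>z\<in>ball 0 1. f x \<le> f z)"
proof -
  have "\<forall>\<^sub>F r in at_left 1. h r < - f y"
    using h y(2) by (auto intro: order_tendstoD(2))
  then obtain r where r: "r < 1" "\<And>s. r < s \<Longrightarrow> s < 1 \<Longrightarrow> h s < - f y"
    unfolding eventually_at_left_field by auto
  have outside: "f y < f z" if "z \<in> ball 0 1" "z \<notin> cball 0 r" for z
    using bound[OF that(1)] r(2)[of "norm z"] that by auto
  have yK: "y \<in> cball 0 r" using outside y(1) by blast
  have "lsc_on (cball 0 r) f"
    by (rule lsc_on_subset[OF lsc]) (use r(1) in auto)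
  then have "\<exists>x\<in>cball 0 r. \<forall>z\<in>cball 0 r. f x \<le> f z"
    using yK by (intro lsc_attains_inf compact_cball) blast+
  then obtain x where x: "x \<in> cball 0 r" "\<And>z. z \<in> cball 0 r \<Longrightarrow> f x \<le> f z"
    by blast
  have "f x \<le> f z" if "z \<in> ball 0 1" for z
    using x(2)[of z] x(2)[OF yK] outside[OF that] by linarith
  then show ?thesis using x(1) x(2)[OF yK] y(2) r(1) by (intro bexI[of _ x]) auto
qed

definition gaussian :: "real \<Rightarrow> real \<Rightarrow> real^'n::finite \<Rightarrow> real" where
  "gaussian \<alpha> k x = exp (- \<alpha> * (norm x)\<^sup>2) + k"

lemma partial_deriv_eqI:
  assumes "(f has_derivative D) (at x)"
  shows "partial_deriv i f x = D (axis i 1)"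
  using frechet_derivative_at[OF assms] by (simp add: partial_deriv_def)

lemma gaussian_has_derivative:
  "(gaussian \<alpha> k has_derivative (\<lambda>h. - 2 * \<alpha> * (x \<bullet> h) * exp (- \<alpha> * (norm x)\<^sup>2))) (at x)"
  unfolding gaussian_def[abs_def] power2_norm_eq_inner
  by (auto intro!: derivative_eq_intros simp: inner_commute algebra_simps)

lemma partial_deriv_gaussian:
  "partial_deriv i (gaussian \<alpha> k) = (\<lambda>x. - 2 * \<alpha> * x $ i * exp (- \<alpha> * (norm x)\<^sup>2))"
  by (rule ext, subst partial_deriv_eqI[OF gaussian_has_derivative]) (simp add: inner_axis)

lemma partial_deriv_gaussian_has_derivative:
  "(partial_deriv j (gaussian \<alpha> k) has_derivative
     (\<lambda>h. (4 * \<alpha>\<^sup>2 * x $ j * (x \<bullet> h) - 2 * \<alpha> * h $ j) * exp (- \<alpha> * (norm x)\<^sup>2))) (at x)"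
  unfolding partial_deriv_gaussian power2_norm_eq_inner
  by (auto intro!: derivative_eq_intros bounded_linear.has_derivative[OF bounded_linear_vec_nth]
           simp: inner_commute algebra_simps power2_eq_square)

lemma partial_deriv2_gaussian:
  "partial_deriv i (partial_deriv j (gaussian \<alpha> k)) =
     (\<lambda>x. (4 * \<alpha>\<^sup>2 * x $ i * x $ j - (if i = j then 2 * \<alpha> else 0)) * exp (- \<alpha> * (norm x)\<^sup>2))"
  by (rule ext, subst partial_deriv_eqI[OF partial_deriv_gaussian_has_derivative])
     (simp add: inner_axis, simp add: axis_def)

lemma C2_on_gaussian: "C2_on U (gaussian \<alpha> k)"
  unfolding C2_on_def
proof (intro conjI allI)
  show "gaussian \<alpha> k differentiable_on U"
    unfolding differentiable_on_def
    using differentiable_at_withinI[OF differentiableI[OF gaussian_has_derivative]] by blast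
  show "partial_deriv i (gaussian \<alpha> k) differentiable_on U" for i
    unfolding differentiable_on_def
    using differentiable_at_withinI[OF differentiableI[OF partial_deriv_gaussian_has_derivative]]
    by blast
  show "continuous_on U (partial_deriv i (partial_deriv j (gaussian \<alpha> k)))" for i j
    unfolding partial_deriv2_gaussian by (intro continuous_intros)
qed

lemma elliptic_op_gaussian:
  "elliptic_op a b c (gaussian \<alpha> k) x =
     exp (- \<alpha> * (norm x)\<^sup>2) *
       (4 * \<alpha>\<^sup>2 * (\<Sum>i\<in>UNIV. \<Sum>j\<in>UNIV. a x $ i $ j * x $ i * x $ j)
        - 2 * \<alpha> * (\<Sum>i\<in>UNIV. a x $ i $ i) - 2 * \<alpha> * (\<Sum>i\<in>UNIV. b x $ i * x $ i))
     + c x * gaussian \<alpha> k x"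
proof -
  let ?e = "exp (- \<alpha> * (norm x)\<^sup>2)"
  have "(\<Sum>j\<in>UNIV. a x $ i $ j * partial_deriv i (partial_deriv j (gaussian \<alpha> k)) x)
      = 4 * \<alpha>\<^sup>2 * ?e * (\<Sum>j\<in>UNIV. a x $ i $ j * x $ i * x $ j) - 2 * \<alpha> * ?e * a x $ i $ i" for i
  proof -
    have "(\<Sum>j\<in>UNIV. a x $ i $ j * partial_deriv i (partial_deriv j (gaussian \<alpha> k)) x)
      = (\<Sum>j\<in>UNIV. 4 * \<alpha>\<^sup>2 * ?e * (a x $ i $ j * x $ i * x $ j)
          - (if i = j then 2 * \<alpha> * ?e * a x $ i $ j else 0))"
      by (rule sum.cong) (auto simp: partial_deriv2_gaussian algebra_simps)
    then show ?thesis by (simp add: sum_subtractf sum_distrib_left)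
  qed
  then have "(\<Sum>i\<in>UNIV. \<Sum>j\<in>UNIV. a x $ i $ j * partial_deriv i (partial_deriv j (gaussian \<alpha> k)) x)
     = 4 * \<alpha>\<^sup>2 * ?e * (\<Sum>i\<in>UNIV. \<Sum>j\<in>UNIV. a x $ i $ j * x $ i * x $ j)
        - 2 * \<alpha> * ?e * (\<Sum>i\<in>UNIV. a x $ i $ i)"
    by (simp only: sum_subtractf sum_distrib_left)
  moreover have "(\<Sum>i\<in>UNIV. b x $ i * partial_deriv i (gaussian \<alpha> k) x)
      = - 2 * \<alpha> * ?e * (\<Sum>i\<in>UNIV. b x $ i * x $ i)"
    unfolding partial_deriv_gaussian sum_distrib_left by (rule sum.cong) auto
  ultimately show ?thesis
    unfolding elliptic_op_def by (simp only:) (simp add: algebra_simps)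
qed

text \<open>The hypothesis on \<open>\<alpha>\<close> says that the quadratic term, at least \<open>4\<alpha>\<^sup>2 lam \<delta>\<^sup>2\<close>, exceeds by 1 the sum
  of the bounds \<open>2\<alpha>n Lam\<close> for the trace, \<open>2\<alpha>n Lam\<close> for the drift and \<open>Lam\<close> for the zeroth-order
  term, all relative to the factor \<open>exp (-\<alpha>|x|\<^sup>2)\<close>. The conditions on \<open>k\<close> say
  \<open>0 \<le> gaussian \<alpha> k x \<le> exp (-\<alpha>|x|\<^sup>2)\<close>, which yields the bound of the zeroth-order term.\<close>

lemma elliptic_op_gaussian_ge:
  fixes x :: "real^'n::finite"
  assumes coeff: "\<And>i j. \<bar>a x $ i $ j\<bar> + \<bar>b x $ i\<bar> + \<bar>c x\<bar> \<le> Lam"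
    and ellip: "(\<Sum>i\<in>UNIV. \<Sum>j\<in>UNIV. a x $ i $ j * x $ i * x $ j) \<ge> lam * (norm x)\<^sup>2"
    and lam: "lam \<ge> 0" and x: "0 \<le> \<delta>" "\<delta> \<le> norm x" "norm x \<le> 1"
    and k: "0 \<le> gaussian \<alpha> k x" "k \<le> 0"
    and \<alpha>: "\<alpha> \<ge> 0" "4 * \<alpha>\<^sup>2 * (lam * \<delta>\<^sup>2) \<ge> 4 * \<alpha> * (real CARD('n) * Lam) + Lam + 1"
  shows "elliptic_op a b c (gaussian \<alpha> k) x \<ge> exp (- \<alpha>)"
proof -
  let ?e = "exp (- \<alpha> * (norm x)\<^sup>2)" and ?n = "real CARD('n)"
  let ?Q = "\<Sum>i\<in>UNIV. \<Sum>j\<in>UNIV. a x $ i $ j * x $ i * x $ j"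
  let ?T = "\<Sum>i\<in>UNIV. a x $ i $ i" and ?B = "\<Sum>i\<in>UNIV. b x $ i * x $ i"
  have aL: "\<bar>a x $ i $ j\<bar> \<le> Lam" and bL: "\<bar>b x $ i\<bar> \<le> Lam" and cL: "\<bar>c x\<bar> \<le> Lam" for i j
    using coeff[of i j] by auto
  have "lam * \<delta>\<^sup>2 \<le> lam * (norm x)\<^sup>2"
    using lam x by (intro mult_left_mono power_mono) auto
  then have Q: "4 * \<alpha>\<^sup>2 * (lam * \<delta>\<^sup>2) \<le> 4 * \<alpha>\<^sup>2 * ?Q"
    using ellip by (intro mult_left_mono) auto
  have "?T \<le> ?n * Lam"
    using sum_bounded_above[of UNIV "\<lambda>i. a x $ i $ i" Lam] aL abs_le_D1 by auto
  then have T: "2 * \<alpha> * ?T \<le> 2 * \<alpha> * (?n * Lam)"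
    using \<alpha>(1) by (intro mult_left_mono) auto
  have "b x $ i * x $ i \<le> Lam" for i
  proof -
    have "\<bar>b x $ i * x $ i\<bar> \<le> Lam * 1"
      unfolding abs_mult using bL[of i] component_le_norm_cart[of x i] x(3)
      by (intro mult_mono) auto
    then show ?thesis by simp
  qed
  then have "?B \<le> ?n * Lam"
    using sum_bounded_above[of UNIV "\<lambda>i. b x $ i * x $ i" Lam] by auto
  then have B: "2 * \<alpha> * ?B \<le> 2 * \<alpha> * (?n * Lam)"
    using \<alpha>(1) by (intro mult_left_mono) auto
  have "\<bar>c x * gaussian \<alpha> k x\<bar> \<le> Lam * ?e"
    unfolding abs_mult using cL k by (intro mult_mono) (auto simp: gaussian_def)
  then have C: "- (?e * Lam) \<le> c x * gaussian \<alpha> k x" by (simp add: mult.commute abs_le_iff)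
  have "Lam + 1 \<le> 4 * \<alpha>\<^sup>2 * ?Q - 2 * \<alpha> * ?T - 2 * \<alpha> * ?B"
    using Q T B \<alpha>(2) by linarith
  then have "?e * (Lam + 1) \<le> ?e * (4 * \<alpha>\<^sup>2 * ?Q - 2 * \<alpha> * ?T - 2 * \<alpha> * ?B)"
    by (intro mult_left_mono) auto
  then have "?e \<le> elliptic_op a b c (gaussian \<alpha> k) x"
    unfolding elliptic_op_gaussian using C by (simp add: algebra_simps)
  moreover have "exp (- \<alpha>) \<le> ?e"
    using mult_left_le[of "(norm x)\<^sup>2" \<alpha>] \<alpha>(1) x(3) by (simp add: power_le_one)
  ultimately show ?thesis by linarith
qed

text \<open>The constant \<open>- exp (-\<alpha>)\<close> makes the barrier vanish on the unit sphere, which keeps the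
  contact point in the interior; \<open>u \<ge> 1\<close> on the inner ball keeps it out of the region where the
  barrier may fail to be a strict subsolution.\<close>

lemma viscosity_supersolution_ge_gaussian:
  fixes u :: "real^'n::finite \<Rightarrow> real"
  assumes coeff: "\<And>x i j. x \<in> ball 0 1 \<Longrightarrow> \<bar>a x $ i $ j\<bar> + \<bar>b x $ i\<bar> + \<bar>c x\<bar> \<le> Lam"
    and ellip: "\<And>x \<xi>. x \<in> ball 0 1 \<Longrightarrow>
      (\<Sum>i\<in>UNIV. \<Sum>j\<in>UNIV. a x $ i $ j * \<xi> $ i * \<xi> $ j) \<ge> lam * (norm \<xi>)\<^sup>2"
    and lam: "lam \<ge> 0" and \<delta>: "\<delta> \<ge> 0"
    and \<alpha>: "\<alpha> \<ge> 0" "4 * \<alpha>\<^sup>2 * (lam * \<delta>\<^sup>2) \<ge> 4 * \<alpha> * (real CARD('n) * Lam) + Lam + 1"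
    and lsc: "lsc_on (ball 0 1) u"
    and super: "viscosity_supersolution_on (ball 0 1) a b c \<epsilon> u" and \<epsilon>: "\<epsilon> < exp (- \<alpha>)"
    and inner: "\<And>x. x \<in> ball 0 \<delta> \<Longrightarrow> u x \<ge> 1"
    and nonneg: "\<And>x. x \<in> ball 0 1 \<Longrightarrow> u x \<ge> 0"
    and y: "y \<in> ball 0 1"
  shows "u y \<ge> gaussian \<alpha> (- exp (- \<alpha>)) y"
proof (rule ccontr)
  let ?\<phi> = "gaussian \<alpha> (- exp (- \<alpha>)) :: real^'n \<Rightarrow> real"
  let ?h = "\<lambda>r::real. exp (- \<alpha> * r\<^sup>2) - exp (- \<alpha>)"
  assume "\<not> ?thesis"
  then have neg: "u y - ?\<phi> y < 0" by simp
  have "continuous_on (ball 0 1) ?\<phi>"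
    unfolding gaussian_def[abs_def] by (intro continuous_intros)
  then have lsc': "lsc_on (ball 0 1) (\<lambda>x. u x - ?\<phi> x)"
    by (rule lsc_on_diff_continuous[OF lsc])
  have bound: "u x - ?\<phi> x \<ge> - ?h (norm x)" if "x \<in> ball 0 1" for x
    using nonneg[OF that] by (simp add: gaussian_def)
  have h: "(?h \<longlongrightarrow> 0) (at_left 1)"
    by (auto intro!: tendsto_eq_intros)
  obtain x where x: "x \<in> ball 0 1" "u x - ?\<phi> x < 0"
    and min: "\<And>z. z \<in> ball 0 1 \<Longrightarrow> u x - ?\<phi> x \<le> u z - ?\<phi> z"
    using lsc_attains_negative_inf_ball[OF lsc' bound h y neg] by auto
  define k where "k = u x - exp (- \<alpha> * (norm x)\<^sup>2)"
  have shift: "gaussian \<alpha> k z = ?\<phi> z + (u x - ?\<phi> x)" for z :: "real^'n"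
    by (simp add: gaussian_def k_def)
  have "\<forall>\<^sub>F z in nhds x. gaussian \<alpha> k z \<le> u z"
  proof (rule eventually_mono)
    show "\<forall>\<^sub>F z in nhds x. z \<in> ball 0 1"
      using x(1) by (intro eventually_nhds_in_open) auto
    show "gaussian \<alpha> k z \<le> u z" if "z \<in> ball 0 1" for z
      using min[OF that] by (simp add: shift)
  qed
  moreover have touch: "gaussian \<alpha> k x = u x" by (simp add: gaussian_def k_def)
  \<comment> \<open>\<open>gaussian \<alpha> k\<close> is the barrier lowered until it touches \<open>u\<close> at \<open>x\<close>, hence a test function.\<close>
  ultimately have "elliptic_op a b c (gaussian \<alpha> k) x \<le> \<epsilon>"
    using super x(1) C2_on_gaussian[of UNIV \<alpha> k] open_UNIV
    unfolding viscosity_supersolution_on_def by blast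
  moreover have "exp (- \<alpha>) \<le> elliptic_op a b c (gaussian \<alpha> k) x"
  proof (rule elliptic_op_gaussian_ge[where \<delta> = \<delta> and lam = lam and Lam = Lam])
    show "\<delta> \<le> norm x"
    proof (rule ccontr)
      assume "\<not> \<delta> \<le> norm x"
      then have "u x \<ge> 1" using inner by simp
      moreover have "exp (- \<alpha> * (norm x)\<^sup>2) \<le> 1" using \<alpha>(1) by simp
      ultimately show False
        using x(2) exp_gt_zero[of "- \<alpha>"] unfolding gaussian_def by linarith
    qed
    show "k \<le> 0" using x(2) exp_gt_zero[of "- \<alpha>"] unfolding k_def gaussian_def by linarith
    show "0 \<le> gaussian \<alpha> k x" using touch nonneg[OF x(1)] by simp
  qed (use coeff ellip lam \<delta> \<alpha> x(1) in auto)
  ultimately show False using \<epsilon> by simp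
qed

text \<open>Convexity of the exponential bounds the barrier below by its linearization in \<open>1 - |x|\<^sup>2\<close>.\<close>

lemma gaussian_ge_dist_sphere:
  assumes "\<alpha> \<ge> 0" and "norm x \<le> 1"
  shows "gaussian \<alpha> (- exp (- \<alpha>)) x \<ge> \<alpha> * exp (- \<alpha>) * (1 - norm x)"
proof -
  have "(norm x)\<^sup>2 \<le> norm x"
    using assms(2) by (simp add: power2_eq_square mult_left_le)
  then have "\<alpha> * (1 - norm x) \<le> \<alpha> * (1 - (norm x)\<^sup>2)"
    using assms(1) by (intro mult_left_mono) auto
  also have "\<dots> \<le> exp (\<alpha> * (1 - (norm x)\<^sup>2)) - 1"
    using exp_ge_add_one_self[of "\<alpha> * (1 - (norm x)\<^sup>2)"] by linarith
  finally have "exp (- \<alpha>) * (\<alpha> * (1 - norm x)) \<le> exp (- \<alpha>) * (exp (\<alpha> * (1 - (norm x)\<^sup>2)) - 1)"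
    by (intro mult_left_mono) auto
  also have "\<dots> = gaussian \<alpha> (- exp (- \<alpha>)) x"
    by (simp add: gaussian_def right_diff_distrib exp_add[symmetric])
  finally show ?thesis by (simp add: mult_ac)
qed

theorem lemma1p2:
  fixes lam Lam \<delta> :: real
  assumes "lam > 0" and "Lam > 0" and "0 < \<delta>" and "\<delta> < 1"
  shows "\<exists>\<epsilon>>0. \<exists>\<mu>>0.
    \<forall>(a :: real^'n::finite \<Rightarrow> real^'n^'n) (b :: real^'n \<Rightarrow> real^'n) (c :: real^'n \<Rightarrow> real)
      (u :: real^'n \<Rightarrow> real).
      (\<forall>i j. bounded_measurable_on (ball 0 1) (\<lambda>x. a x $ i $ j)) \<longrightarrow>
      (\<forall>i. bounded_measurable_on (ball 0 1) (\<lambda>x. b x $ i)) \<longrightarrow>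
      bounded_measurable_on (ball 0 1) c \<longrightarrow>
      (\<forall>x\<in>ball 0 1. \<forall>i j. \<bar>a x $ i $ j\<bar> + \<bar>b x $ i\<bar> + \<bar>c x\<bar> \<le> Lam) \<longrightarrow>
      (\<forall>x\<in>ball 0 1. \<forall>\<xi>. (\<Sum>i\<in>UNIV. \<Sum>j\<in>UNIV. a x $ i $ j * \<xi> $ i * \<xi> $ j) \<ge> lam * (norm \<xi>)\<^sup>2) \<longrightarrow>
      lsc_on (ball 0 1) u \<longrightarrow>
      viscosity_supersolution_on (ball 0 1) a b c \<epsilon> u \<longrightarrow>
      (\<forall>x\<in>ball 0 \<delta>. u x \<ge> 1) \<longrightarrow>
      (\<forall>x\<in>ball 0 1. u x \<ge> 0) \<longrightarrow>
      (\<forall>x\<in>ball 0 1. u x \<ge> \<mu> * (1 - norm x))"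
proof -
  define N where "N = real CARD('n) * Lam"
  \<comment> \<open>With this choice \<open>\<alpha> \<ge> 1\<close> and \<open>4\<alpha> lam \<delta>\<^sup>2 \<ge> 4N + Lam + 1\<close>; multiplying by \<open>\<alpha>\<close> gives the
    condition of the barrier lemmas.\<close>
  define \<alpha> where "\<alpha> = 1 + (4 * N + Lam + 1) / (4 * (lam * \<delta>\<^sup>2))"
  have N: "N \<ge> 0" using assms by (simp add: N_def)
  have d: "lam * \<delta>\<^sup>2 > 0" using assms by simp
  have \<alpha>1: "\<alpha> \<ge> 1" using N d assms by (simp add: \<alpha>_def)
  have "4 * (lam * \<delta>\<^sup>2) * \<alpha> = 4 * (lam * \<delta>\<^sup>2) + (4 * N + Lam + 1)"
    using less_imp_neq[OF d] unfolding \<alpha>_def by (simp only: distrib_left) simp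
  then have "\<alpha> * (4 * N + Lam + 1) \<le> \<alpha> * (4 * (lam * \<delta>\<^sup>2) * \<alpha>)"
    using \<alpha>1 d by (intro mult_left_mono) auto
  moreover have "1 * (Lam + 1) \<le> \<alpha> * (Lam + 1)"
    using \<alpha>1 assms by (intro mult_right_mono) auto
  ultimately have \<alpha>: "4 * \<alpha>\<^sup>2 * (lam * \<delta>\<^sup>2) \<ge> 4 * \<alpha> * (real CARD('n) * Lam) + Lam + 1"
    unfolding N_def[symmetric] by (simp add: algebra_simps power2_eq_square)
  show ?thesis
  proof (rule exI[of _ "exp (- \<alpha>) / 2"], intro conjI exI[of _ "\<alpha> * exp (- \<alpha>)"] allI impI ballI)
    show "exp (- \<alpha>) / 2 > 0" and "\<alpha> * exp (- \<alpha>) > 0" using \<alpha>1 by auto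
  next
    fix a :: "real^'n \<Rightarrow> real^'n^'n" and b c and u :: "real^'n \<Rightarrow> real" and x :: "real^'n"
    assume "\<forall>x\<in>ball 0 1. \<forall>i j. \<bar>a x $ i $ j\<bar> + \<bar>b x $ i\<bar> + \<bar>c x\<bar> \<le> Lam"
      and "\<forall>x\<in>ball 0 1. \<forall>\<xi>. (\<Sum>i\<in>UNIV. \<Sum>j\<in>UNIV. a x $ i $ j * \<xi> $ i * \<xi> $ j) \<ge> lam * (norm \<xi>)\<^sup>2"
      and "lsc_on (ball 0 1) u"
      and "viscosity_supersolution_on (ball 0 1) a b c (exp (- \<alpha>) / 2) u"
      and "\<forall>x\<in>ball 0 \<delta>. u x \<ge> 1" and "\<forall>x\<in>ball 0 1. u x \<ge> 0" and x: "x \<in> ball 0 1"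
    then have "u x \<ge> gaussian \<alpha> (- exp (- \<alpha>)) x"
      using assms \<alpha>1 \<alpha>
      by (intro viscosity_supersolution_ge_gaussian[of a b c Lam lam \<delta> \<alpha> u "exp (- \<alpha>) / 2"]) auto
    then show "u x \<ge> \<alpha> * exp (- \<alpha>) * (1 - norm x)"
      using gaussian_ge_dist_sphere[of \<alpha> x] \<alpha>1 x by simp
  qed
qed

end
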